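(* Let $d\ge 2$ and let $P$ be a $d$-simplex, with $n=d+1$ vertices and $m=d+1$ facets. Let $I^z=\{(i,j):\text{vertex } i \text{ lies on facet } j\}$ and set $\lambda_{ij}=\frac{2d^2}{d+1}$ for all $(i,j)\notin I^z$. Then the semidefinite program $$\min_X\ \mathrm{tr}(X)-\sum_{(i,j)\notin I^z}\lambda_{ij}S_{ij}\quad\text{s.t.}\quad X=\begin{bmatrix}1 & \mathbb{1}_n^\top & \mathbb{1}_m^\top\\ \mathbb{1}_n & A & S\\ \mathbb{1}_m & S^\top & B\end{bmatrix}\succeq 0,\ \ S_{ij}=0 \text{ for }(i,j)\in I^z,\ \ A_{ii}=2\ (i=1,\ldots,n)$$ has an optimal solution $X$ of rank $d+1$ whose block $S$ satisfies $S_{ij}>0$ for all $(i,j)\notin I^z$; such a solution certifies the inscribability of the $d$-simplex.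
   Context: A polytope is inscribable if some combinatorially equivalent polytope has all its vertices on a sphere. In the program, $A$ ($n\times n$) and $B$ ($m\times m$) are symmetric and $S$ is $n\times m$, all real; $\mathbb{1}_k$ is the all-ones vector. By the paper's characterization, a $d$-polytope is inscribable iff there is such a positive semidefinite $X$ of rank $d+1$ with constant diagonal in $A$, $S\ge 0$, and $S$ having exactly the zero pattern $I^z$. *)

theory Defs
  imports "HOL-Analysis.Analysis"
begin

definition combinatorially_equivalent ::
    "'a::euclidean_space set \<Rightarrow> 'b::euclidean_space set \<Rightarrow> bool" where
  "combinatorially_equivalent P Q \<longleftrightarrow>
     (\<exists>\<phi>. bij_betw \<phi> {F. F face_of P} {G. G face_of Q} \<and>
          (\<forall>F G. F face_of P \<longrightarrow> G face_of P \<longrightarrow> (F \<subseteq> G \<longleftrightarrow> \<phi> F \<subseteq> \<phi> G)))"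

(* The dimension of Q is forced by the face lattice, so Q can be sought in the ambient space of P.
   If Q is not full-dimensional there, its vertices still lie on a sphere of its affine hull. *)
definition inscribable :: "'a::euclidean_space set \<Rightarrow> bool" where
  "inscribable P \<longleftrightarrow>
     (\<exists>Q :: 'a set. polytope Q \<and> combinatorially_equivalent P Q \<and>
        (\<exists>c r. 0 < r \<and> {x. x extreme_point_of Q} \<subseteq> sphere c r))"

definition psd :: "real^'k^'k \<Rightarrow> bool" where
  "psd X \<longleftrightarrow> transpose X = X \<and> (\<forall>x. 0 \<le> x \<bullet> (X *v x))"

text \<open>A matrix of type \<open>real^'m^'n\<close> has rows indexed by \<open>'n\<close> and columns by \<open>'m\<close>; the index type
  \<open>unit + 'n + 'm\<close> splits a matrix into blocks of sizes \<open>1\<close>, \<open>n\<close>, \<open>m\<close>.\<close>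

definition bordered_block ::
    "real^'n^'n \<Rightarrow> real^'m^'n \<Rightarrow> real^'m^'m \<Rightarrow> real^(unit + 'n + 'm)^(unit + 'n + 'm)" where
  "bordered_block A S B =
     (\<chi> p q. case p of
        Inl _ \<Rightarrow> 1
      | Inr (Inl i) \<Rightarrow> (case q of Inl _ \<Rightarrow> 1 | Inr (Inl k) \<Rightarrow> A $ i $ k | Inr (Inr j) \<Rightarrow> S $ i $ j)
      | Inr (Inr j) \<Rightarrow> (case q of Inl _ \<Rightarrow> 1 | Inr (Inl i) \<Rightarrow> S $ i $ j | Inr (Inr l) \<Rightarrow> B $ j $ l))"

definition sdp_feasible ::
    "('n \<times> 'm) set \<Rightarrow> real^'n^'n \<Rightarrow> real^'m^'n \<Rightarrow> real^'m^'m \<Rightarrow> bool" where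
  "sdp_feasible Iz A S B \<longleftrightarrow>
     transpose A = A \<and> transpose B = B \<and> psd (bordered_block A S B) \<and>
     (\<forall>(i, j) \<in> Iz. S $ i $ j = 0) \<and> (\<forall>i. A $ i $ i = 2)"

definition sdp_objective ::
    "('n \<times> 'm) set \<Rightarrow> ('n \<Rightarrow> 'm \<Rightarrow> real) \<Rightarrow> real^'n^'n \<Rightarrow> real^'m^'n \<Rightarrow> real^'m^'m \<Rightarrow> real" where
  "sdp_objective Iz lam A S B =
     trace (bordered_block A S B) - (\<Sum>(i, j) \<in> - Iz. lam i j * S $ i $ j)"

definition sdp_optimal ::
    "('n \<times> 'm) set \<Rightarrow> ('n \<Rightarrow> 'm \<Rightarrow> real) \<Rightarrow> real^'n^'n \<Rightarrow> real^'m^'n \<Rightarrow> real^'m^'m \<Rightarrow> bool" where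
  "sdp_optimal Iz lam A S B \<longleftrightarrow>
     sdp_feasible Iz A S B \<and>
     (\<forall>A' S' B'. sdp_feasible Iz A' S' B' \<longrightarrow>
        sdp_objective Iz lam A S B \<le> sdp_objective Iz lam A' S' B')"

(* Matrices that characterize inscribability: a d-polytope with vertex-facet incidences Iz
   is inscribable iff such A, S, B exist. *)
definition inscribability_certificate ::
    "nat \<Rightarrow> ('n \<times> 'm) set \<Rightarrow> real^'n^'n \<Rightarrow> real^'m^'n \<Rightarrow> real^'m^'m \<Rightarrow> bool" where
  "inscribability_certificate d Iz A S B \<longleftrightarrow>
     transpose A = A \<and> transpose B = B \<and>
     psd (bordered_block A S B) \<and> rank (bordered_block A S B) = d + 1 \<and>
     (\<exists>c. \<forall>i. A $ i $ i = c) \<and>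
     (\<forall>i j. 0 \<le> S $ i $ j) \<and> (\<forall>i j. S $ i $ j = 0 \<longleftrightarrow> (i, j) \<in> Iz)"

end

theory Submission
  imports Defs
begin

text \<open>
  Every facet \<open>j\<close> of a simplex misses exactly one vertex \<open>\<sigma> j\<close>. Let \<open>u\<^sub>i\<close> be the unit vectors
  pointing to the vertices of a regular \<open>d\<close>-simplex centred at the origin, and \<open>e\<close> a unit vector
  orthogonal to them. The solution is the Gram matrix of \<open>e\<close>, the vectors \<open>p\<^sub>i = e + u\<^sub>i\<close> and the
  vectors \<open>q\<^sub>j = e + d u\<^bsub>\<sigma> j\<^esub>\<close>. These satisfy the linear relations
  \<open>q\<^sub>j - d p\<^bsub>\<sigma> j\<^esub> + d/(d+1) \<Sum>\<^sub>i p\<^sub>i - e = 0\<close> and \<open>\<Sum>\<^sub>i p\<^sub>i = (d+1) e\<close>. Evaluating the quadratic form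
  of an arbitrary feasible matrix at these coefficient vectors and adding up yields exactly the
  objective value of the regular simplex as a lower bound. The simplex itself is inscribed, since
  affinely independent points have a circumsphere.
\<close>

section \<open>Trace, quadratic form and rank of bordered block matrices\<close>

lemma sum_over_blocks:
  fixes f :: "unit + 'n::finite + 'm::finite \<Rightarrow> 'b::comm_monoid_add"
  shows "sum f UNIV = f (Inl ()) + (\<Sum>i\<in>UNIV. f (Inr (Inl i))) + (\<Sum>j\<in>UNIV. f (Inr (Inr j)))"
  by (simp add: UNIV_Plus_UNIV[symmetric] sum.Plus UNIV_unit add.assoc del: UNIV_Plus_UNIV)

lemma trace_bordered_block:
  fixes A :: "real^'n::finite^'n" and B :: "real^'m::finite^'m"
  shows "trace (bordered_block A S B) = 1 + trace A + trace B"
  by (simp add: trace_def sum_over_blocks bordered_block_def)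

lemma quadratic_form_sum:
  fixes A :: "real^'n::finite^'n"
  shows "x \<bullet> (A *v x) = (\<Sum>i\<in>UNIV. \<Sum>k\<in>UNIV. x $ i * A $ i $ k * x $ k)"
  by (simp add: inner_vec_def matrix_vector_mult_def sum_distrib_left mult.assoc)

lemma quadratic_form_bordered_block:
  fixes A :: "real^'n::finite^'n" and S :: "real^'m::finite^'n" and B :: "real^'m^'m"
    and x :: "real^(unit + 'n + 'm)"
  defines "a \<equiv> x $ Inl ()" and "y \<equiv> \<chi> i. x $ Inr (Inl i)" and "z \<equiv> \<chi> j. x $ Inr (Inr j)"
  shows "x \<bullet> (bordered_block A S B *v x) =
           a\<^sup>2 + 2 * a * (\<Sum>i\<in>UNIV. y $ i) + 2 * a * (\<Sum>j\<in>UNIV. z $ j)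
             + y \<bullet> (A *v y) + 2 * (y \<bullet> (S *v z)) + z \<bullet> (B *v z)"
proof -
  have S: "y \<bullet> (S *v z) = (\<Sum>i\<in>UNIV. \<Sum>j\<in>UNIV. y $ i * S $ i $ j * z $ j)"
    by (simp add: inner_vec_def matrix_vector_mult_def sum_distrib_left mult.assoc)
  \<comment> \<open>The transposed block contributes this second double sum. Exchanging the
    summations identifies it with the first one, hence the factor 2 in front of the mixed
    term.\<close>
  have S': "y \<bullet> (S *v z) = (\<Sum>j\<in>UNIV. \<Sum>i\<in>UNIV. z $ j * S $ i $ j * y $ i)"
    unfolding S by (subst sum.swap) (simp add: mult_ac)
  have "x \<bullet> (bordered_block A S B *v x) =
           a\<^sup>2 + 2 * a * (\<Sum>i\<in>UNIV. y $ i) + 2 * a * (\<Sum>j\<in>UNIV. z $ j)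
             + y \<bullet> (A *v y) + (\<Sum>i\<in>UNIV. \<Sum>j\<in>UNIV. y $ i * S $ i $ j * z $ j)
             + (\<Sum>j\<in>UNIV. \<Sum>i\<in>UNIV. z $ j * S $ i $ j * y $ i) + z \<bullet> (B *v z)"
    by (simp add: quadratic_form_sum sum_over_blocks bordered_block_def a_def y_def z_def
        sum.distrib sum_distrib_left sum_distrib_right power2_eq_square algebra_simps)
  then show ?thesis
    using S S' by simp
qed

lemma psd_gram:
  fixes R :: "real^'k::finite^'n::finite"
  shows "psd (transpose R ** R)"
  by (simp add: psd_def matrix_transpose_mul flip: matrix_vector_mul_assoc)
    (metis dot_lmul_matrix inner_ge_zero transpose_matrix_vector inner_commute)

text \<open>Dropping coordinates is linear and maps suitable columns of the block matrix onto the
  columns of \<open>S\<close>, and a linear map cannot raise the dimension of a span. This later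
  bounds the rank of the solution from below.\<close>

lemma rank_le_rank_bordered_block:
  fixes A :: "real^'n::finite^'n" and S :: "real^'m::finite^'n"
  shows "rank S \<le> rank (bordered_block A S B)"
proof -
  let ?f = "\<lambda>x :: real^(unit + 'n + 'm). \<chi> i. x $ Inr (Inl i)"
  have lin: "linear ?f"
    by (auto intro!: linearI simp: vec_eq_iff)
  have "columns S \<subseteq> ?f ` columns (bordered_block A S B)"
  proof
    fix c assume "c \<in> columns S"
    then obtain j where "c = column j S"
      by (auto simp: columns_def)
    then have "c = ?f (column (Inr (Inr j)) (bordered_block A S B))"
      by (simp add: column_def bordered_block_def vec_eq_iff)
    then show "c \<in> ?f ` columns (bordered_block A S B)"
      by (auto simp: columns_def)
  qed
  then have "dim (columns S) \<le> dim (?f ` columns (bordered_block A S B))"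
    by (rule dim_subset)
  also have "\<dots> \<le> dim (columns (bordered_block A S B))"
    by (rule dim_image_le[OF lin])
  finally show ?thesis
    by (simp add: column_rank_def)
qed

section \<open>Circumspheres and vertex-facet incidences of simplices\<close>

lemma affine_independent_equidistant:
  fixes C :: "'a::euclidean_space set"
  assumes "\<not> affine_dependent C"
  obtains c r where "C \<subseteq> sphere c r"
proof (cases "C = {}")
  case False
  then obtain a where a: "a \<in> C" by blast
  let ?D = "(\<lambda>x. - a + x) ` (C - {a})"
  have "independent ?D"
    using assms a affine_dependent_iff_dependent2 by blast
  \<comment> \<open>The centre is sought as \<open>a + w\<close>. For y = x - a, the condition |w -
    y| = |w| means y . w = y . y / 2. This prescribes a linear functional on the independent set
    \<open>?D\<close>, and \<open>w\<close> represents a linear extension of it.\<close>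
  from linear_independent_extend[OF this, of "\<lambda>y. y \<bullet> y / 2"]
  obtain g :: "'a \<Rightarrow> real" where g: "linear g" "\<And>y. y \<in> ?D \<Longrightarrow> g y = y \<bullet> y / 2"
    by blast
  define w where "w = adjoint g 1"
  have w: "y \<bullet> w = g y" for y
    unfolding w_def by (simp add: adjoint_works[OF g(1)])
  have "dist (a + w) x = norm w" if "x \<in> C" for x
  proof (cases "x = a")
    case False
    then have "2 * ((x - a) \<bullet> w) = (x - a) \<bullet> (x - a)"
      using g(2)[of "x - a"] that by (force simp: w)
    then have "(w - (x - a)) \<bullet> (w - (x - a)) = w \<bullet> w"
      by (simp add: inner_diff_left inner_diff_right inner_commute)
    then show ?thesis
      by (simp add: dist_norm norm_eq_sqrt_inner algebra_simps)
  qed (simp add: dist_norm)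
  then show thesis
    by (intro that[of "a + w" "norm w"]) auto
qed (use that in auto)

lemma inscribable_simplex:
  fixes P :: "'a::euclidean_space set"
  assumes "n simplex P" "n \<ge> 1"
  shows "inscribable P"
proof -
  obtain C where C: "\<not> affine_dependent C" "int (card C) = n + 1" "P = convex hull C"
    using assms(1) by (auto simp: simplex_def)
  have vertices: "{x. x extreme_point_of P} = C"
    using C by (simp add: extreme_point_of_convex_hull_affine_independent)
  obtain c r where cr: "C \<subseteq> sphere c r"
    using affine_independent_equidistant[OF C(1)] .
  \<comment> \<open>A sphere of radius at most 0 has at most one point, while
    \<open>n \<ge> 1\<close> provides at least two vertices.\<close>
  have "r > 0"
  proof (rule ccontr)
    assume "\<not> r > 0"
    then have "sphere c r \<subseteq> {c}"
      by (auto simp: sphere_def)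
    then have "card C \<le> 1"
      using cr card_mono[of "{c}" C] by auto
    then show False
      using C(2) assms(2) by simp
  qed
  moreover have "combinatorially_equivalent P P"
    unfolding combinatorially_equivalent_def by (rule exI[of _ id]) auto
  moreover have "polytope P"
    using assms(1) by (rule simplex_imp_polytope)
  ultimately show ?thesis
    using cr vertices unfolding inscribable_def by blast
qed

text \<open>A facet of a simplex is the hull of all vertices but one, and affine independence keeps
  the omitted vertex off it. Since \<open>F\<close> is injective, distinct facets omit distinct
  vertices, and equal cardinalities make this assignment bijective.\<close>

lemma simplex_facet_opposite_vertex:
  fixes P :: "'a::euclidean_space set"
    and v :: "'n::finite \<Rightarrow> 'a" and F :: "'m::finite \<Rightarrow> 'a set"
  assumes P: "k simplex P"
    and cards: "CARD('n) = CARD('m)"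
    and v: "bij_betw v UNIV {x. x extreme_point_of P}"
    and F: "bij_betw F UNIV {f. f facet_of P}"
  obtains \<sigma> :: "'m \<Rightarrow> 'n" where "bij \<sigma>" "\<And>i j. v i \<in> F j \<longleftrightarrow> i \<noteq> \<sigma> j"
proof -
  obtain C where C: "\<not> affine_dependent C" "P = convex hull C"
    using P by (auto simp: simplex_def)
  have inj_v: "inj v" and range_v: "range v = C"
    using v C by (auto simp: bij_betw_def extreme_point_of_convex_hull_affine_independent)
  have "\<exists>i. F j = convex hull (C - {v i})" for j
  proof -
    have "F j facet_of P"
      using F by (auto simp: bij_betw_def)
    then show ?thesis
      using C range_v by (auto simp: facet_of_convex_hull_affine_independent)
  qed
  then obtain \<sigma> where \<sigma>: "\<And>j. F j = convex hull (C - {v (\<sigma> j)})"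
    by metis
  have "inj \<sigma>"
    using F \<sigma> by (metis bij_betw_def inj_on_def)
  then have "bij \<sigma>"
    using cards by (metis bij_betw_def card_image card_subset_eq finite_class.finite_UNIV subset_UNIV)
  moreover have "v i \<in> F j \<longleftrightarrow> i \<noteq> \<sigma> j" for i j
  proof
    assume "v i \<in> F j"
    then have "v i \<in> affine hull (C - {v (\<sigma> j)})"
      using \<sigma> convex_hull_subset_affine_hull by blast
    then show "i \<noteq> \<sigma> j"
      using C(1) range_v by (auto simp: affine_dependent_def)
  next
    assume "i \<noteq> \<sigma> j"
    then have "v i \<in> C - {v (\<sigma> j)}"
      using inj_v range_v by (auto dest: injD)
    then show "v i \<in> F j"
      using \<sigma> by (simp add: hull_inc)
  qed
  ultimately show thesis
    by (rule that)
qed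

section \<open>Lower bound for the objective over all feasible matrices\<close>

lemma sum_graph_complement:
  fixes \<sigma> :: "'m::finite \<Rightarrow> 'n::finite" and f :: "'n \<Rightarrow> 'm \<Rightarrow> real"
  shows "(\<Sum>(i, j) \<in> - {(i, j). i \<noteq> \<sigma> j}. f i j) = (\<Sum>j\<in>UNIV. f (\<sigma> j) j)"
  by (rule sum.reindex_bij_witness[of _ "\<lambda>j. (\<sigma> j, j)" snd]) auto

lemma sdp_objective_lower_bound:
  fixes \<sigma> :: "'m::finite \<Rightarrow> 'n::finite"
  assumes d: "CARD('n) = d + 1" "d \<ge> 1" and \<sigma>: "bij \<sigma>"
    and lam: "\<And>j. lam (\<sigma> j) j = 2 * (real d)\<^sup>2 / (real d + 1)"
    and feas: "sdp_feasible {(i, j). i \<noteq> \<sigma> j} A S B"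
  shows "sdp_objective {(i, j). i \<noteq> \<sigma> j} lam A S B \<ge> 3 * real d + 4 - real d ^ 2 * (real d + 1)"
proof -
  define n where "n = real d + 1"
  define c where "c = real d / n"
  define T where "T = (\<Sum>i\<in>UNIV. \<Sum>k\<in>UNIV. A $ i $ k)"
  define r where "r i = (\<Sum>k\<in>UNIV. A $ i $ k)" for i
  define s where "s j = S $ \<sigma> j $ j" for j
  have n: "n > 0" "real CARD('n) = n" "real CARD('m) = n"
    using d bij_betw_same_card[OF \<sigma>] by (auto simp: n_def)
  have sym: "A $ i $ k = A $ k $ i" for i k
    using feas by (auto simp: sdp_feasible_def transpose_def vec_eq_iff)
  have diag: "A $ i $ i = 2" and off: "i \<noteq> \<sigma> j \<Longrightarrow> S $ i $ j = 0" for i j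
    using feas by (auto simp: sdp_feasible_def)
  have psd: "0 \<le> x \<bullet> (bordered_block A S B *v x)" for x
    using feas by (simp add: sdp_feasible_def psd_def)
  have col: "(\<Sum>i\<in>UNIV. A $ i $ k) = r k" for k
    unfolding r_def using sym by simp
  have T: "(\<Sum>i\<in>UNIV. r i) = T"
    by (simp add: T_def r_def)

  \<comment> \<open>The test vector holds the coefficients of the relation sum p_i = n e, so the
    inequality is tight for the regular simplex.\<close>
  have "0 \<le> n\<^sup>2 - 2 * n * n + T"
    using psd[of "\<chi> p. case_sum (\<lambda>_. - n) (case_sum (\<lambda>_. 1) (\<lambda>_. 0)) p"] n
    unfolding quadratic_form_bordered_block
    by (simp add: quadratic_form_sum T_def inner_vec_def matrix_vector_mult_def)
  then have T_ge: "n\<^sup>2 \<le> T"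
    by (simp add: power2_eq_square)

  \<comment> \<open>The test vector \<open>x\<close> below holds the coefficients of the relation
    that involves q_j.\<close>
  have key: "0 \<le> - 1 + c\<^sup>2 * T - 2 * c * d * r (\<sigma> j) + 2 * (real d)\<^sup>2 + 2 * (c - d) * s j + B $ j $ j" for j
  proof -
    define y :: "real^'n" where "y = (\<chi> i. c - (if i = \<sigma> j then real d else 0))"
    define z :: "real^'m" where "z = axis j 1"
    define x :: "real^(unit + 'n + 'm)" where
      "x = (\<chi> p. case_sum (\<lambda>_. - 1) (case_sum (\<lambda>i. y $ i) (\<lambda>l. z $ l)) p)"
    have Ay: "(A *v y) $ i = c * r i - d * A $ i $ \<sigma> j" for i
    proof -
      have "(A *v y) $ i = (\<Sum>k\<in>UNIV. c * A $ i $ k - (if k = \<sigma> j then d * A $ i $ k else 0))"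
        by (auto simp: matrix_vector_mult_def y_def algebra_simps intro!: sum.cong)
      then show ?thesis
        by (simp add: sum_subtractf r_def flip: sum_distrib_left)
    qed
    have "y \<bullet> (A *v y) = (\<Sum>i\<in>UNIV. y $ i * (c * r i - d * A $ i $ \<sigma> j))"
      by (simp add: inner_vec_def Ay)
    also have "\<dots> = (\<Sum>i\<in>UNIV. c * (c * r i - d * A $ i $ \<sigma> j)
         - (if i = \<sigma> j then d * (c * r i - d * A $ i $ \<sigma> j) else 0))"
      by (auto simp: y_def algebra_simps intro!: sum.cong)
    also have "\<dots> = c * (c * T - d * r (\<sigma> j)) - d * (c * r (\<sigma> j) - d * 2)"
      by (simp add: sum_subtractf T col diag flip: sum_distrib_left)
    finally have yAy: "y \<bullet> (A *v y) = c\<^sup>2 * T - 2 * c * d * r (\<sigma> j) + 2 * (real d)\<^sup>2"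
      by (simp add: algebra_simps power2_eq_square)
    have "y $ i * S $ i $ j = (if i = \<sigma> j then (c - d) * s j else 0)" for i
      using off by (simp add: y_def s_def)
    then have ySz: "y \<bullet> (S *v z) = (c - d) * s j"
      by (simp add: inner_vec_def z_def matrix_vector_mult_basis column_def)
    have zBz: "z \<bullet> (B *v z) = B $ j $ j"
      by (simp add: z_def matrix_vector_mult_basis column_def inner_axis')
    \<comment> \<open>The value c = d / n is what makes \<open>y\<close> sum to zero. The border
      then contributes only 1 - 2 = -1.\<close>
    have sum_y: "(\<Sum>i\<in>UNIV. y $ i) = 0"
      using n by (simp add: y_def sum_subtractf c_def)
    have sum_z: "(\<Sum>l\<in>UNIV. z $ l) = 1"
      by (simp add: z_def axis_def)
    have blocks: "x $ Inl () = - 1" "(\<chi> i. x $ Inr (Inl i)) = y" "(\<chi> l. x $ Inr (Inr l)) = z"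
      by (simp_all add: x_def vec_eq_iff)
    show ?thesis
      using psd[of x] unfolding quadratic_form_bordered_block blocks
      by (simp add: sum_y sum_z yAy ySz zBz algebra_simps)
  qed
  have "0 \<le> (\<Sum>j\<in>UNIV. - 1 + c\<^sup>2 * T - 2 * c * d * r (\<sigma> j) + 2 * (real d)\<^sup>2 + 2 * (c - d) * s j + B $ j $ j)"
    by (intro sum_nonneg key)
  also have "\<dots> = n * (- 1 + c\<^sup>2 * T + 2 * (real d)\<^sup>2) - 2 * c * d * (\<Sum>j\<in>UNIV. r (\<sigma> j))
      + 2 * (c - d) * (\<Sum>j\<in>UNIV. s j) + trace B"
    unfolding sum.distrib sum_subtractf sum_distrib_left[symmetric] trace_def
    using n by (simp add: algebra_simps)
  \<comment> \<open>Bijectivity of \<open>\<sigma>\<close> makes the individual row sums of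
    \<open>A\<close> disappear: only \<open>T\<close> survives.\<close>
  also have "(\<Sum>j\<in>UNIV. r (\<sigma> j)) = T"
    using sum.reindex_bij_betw[OF \<sigma>, of r] T by simp
  finally have lower: "0 \<le> n * (- 1 + 2 * (real d)\<^sup>2) - (2 * c * d - n * c\<^sup>2) * T
      + 2 * (c - d) * (\<Sum>j\<in>UNIV. s j) + trace B"
    by (simp add: algebra_simps)
  \<comment> \<open>\<open>T\<close> enters \<open>lower\<close> with the factor -d^2 / n, so the
    bound \<open>T_ge\<close> can replace it. The coefficient of the sum of the \<open>s j\<close>
    is exactly minus the prescribed weight \<open>lam\<close>.\<close>
  have coeff_T: "2 * c * d - n * c\<^sup>2 = (real d)\<^sup>2 / n"
    using n by (simp add: c_def field_simps power2_eq_square)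
  have coeff_s: "2 * (c - d) = - (2 * (real d)\<^sup>2 / n)"
    using n(1) by (simp add: c_def field_simps power2_eq_square) (simp add: n_def algebra_simps)
  have "(real d)\<^sup>2 / n * T \<ge> (real d)\<^sup>2 * n"
    using mult_left_mono[OF T_ge, of "(real d)\<^sup>2 / n"] n by (simp add: power2_eq_square)
  with lower have "trace B - 2 * (real d)\<^sup>2 / n * (\<Sum>j\<in>UNIV. s j) \<ge> n - (real d)\<^sup>2 * n"
    unfolding coeff_T coeff_s by (simp add: algebra_simps)
  moreover have "trace A = 2 * n"
    using n by (simp add: trace_def diag)
  ultimately show ?thesis
    unfolding sdp_objective_def sum_graph_complement lam sum_distrib_left[symmetric]
      trace_bordered_block s_def n_def
    by (simp add: algebra_simps)
qed

section \<open>The Gram matrix of the regular simplex and its rank\<close>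

lemma simplex_sdp_solution:
  fixes \<sigma> :: "'m::finite \<Rightarrow> 'n::finite"
  assumes d: "CARD('n) = d + 1" "d \<ge> 1" and \<sigma>: "bij \<sigma>"
  obtains A S B where
    "sdp_feasible {(i, j). i \<noteq> \<sigma> j} A S B"
    "rank (bordered_block A S B) = d + 1"
    "\<And>i j. S $ i $ j = (if i = \<sigma> j then real d + 1 else 0)"
    "trace B = (real d + 1) * (1 + real d ^ 2)"
proof -
  define n where "n = real d + 1"
  have n: "n > 0" "real CARD('n) = n" "d \<noteq> 0"
    using d by (auto simp: n_def)
  define b :: "unit + 'n + 'm \<Rightarrow> real" where
    "b = case_sum (\<lambda>_. 0) (case_sum (\<lambda>_. 1) (\<lambda>_. real d))"
  \<comment> \<open>The undefined value on the border is harmless, because \<open>b\<close> vanishes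
    there.\<close>
  define k :: "unit + 'n + 'm \<Rightarrow> 'n" where
    "k = case_sum (\<lambda>_. undefined) (case_sum (\<lambda>i. i) \<sigma>)"
  \<comment> \<open>A basis vector minus the centroid, of squared length 1 - 1/n = d/n. The factor
    sqrt (n/d) in \<open>R\<close> normalizes it to u_i, and the constant vector 1 / sqrt n is the
    unit vector orthogonal to all of these.\<close>
  define e where "e p i = (if i = k p then 1 else 0) - 1 / n" for p i
  define R :: "real^(unit + 'n + 'm)^'n" where
    "R = (\<chi> i p. 1 / sqrt n + b p * sqrt (n / real d) * e p i)"
  define A :: "real^'n^'n" where
    "A = (\<chi> i j. 1 + (n / d) * ((if i = j then 1 else 0) - 1 / n))"
  \<comment> \<open>The entries are 1 + d (u_i . u_k) with k = \<open>\<sigma> j\<close>. As u_i .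
    u_k = -1/d for distinct indices, the scaling of q_j by d produces the zeros, and the remaining
    entries are 1 + d.\<close>
  define S :: "real^'m^'n" where
    "S = (\<chi> i j. if i = \<sigma> j then n else 0)"
  define B :: "real^'m^'m" where
    "B = (\<chi> i j. 1 + n * d * ((if i = j then 1 else 0) - 1 / n))"
  have sum_e: "(\<Sum>i\<in>UNIV. e p i) = 0" for p
    using n by (simp add: e_def sum_subtractf)
  have sum_ee: "(\<Sum>i\<in>UNIV. e p i * e q i) = (if k p = k q then 1 else 0) - 1 / n" for p q
  proof -
    have "(\<Sum>i\<in>UNIV. e p i * e q i) = (\<Sum>i\<in>UNIV. (if i = k p then e q i else 0) - 1 / n * e q i)"
      by (intro sum.cong) (auto simp: e_def[of p] left_diff_distrib)
    also have "\<dots> = e q (k p)"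
      by (simp add: sum_subtractf sum_e del: sum_divide_distrib flip: sum_distrib_left sum_divide_distrib)
    finally show ?thesis
      by (simp add: e_def)
  qed
  have gram: "(transpose R ** R) $ p $ q =
      1 + b p * b q * (n / d) * ((if k p = k q then 1 else 0) - 1 / n)" for p q
  proof -
    have "(transpose R ** R) $ p $ q =
      (\<Sum>i\<in>UNIV. 1 / n + (sqrt (n / d) / sqrt n) * b p * e p i + (sqrt (n / d) / sqrt n) * b q * e q i
         + b p * b q * (n / d) * (e p i * e q i))"
      unfolding matrix_matrix_mult_def transpose_def R_def
      using n by (auto simp: algebra_simps intro!: sum.cong)
    also have "\<dots> = 1 + b p * b q * (n / d) * ((if k p = k q then 1 else 0) - 1 / n)"
      \<comment> \<open>The mixed terms vanish by \<open>sum_e\<close>.\<close>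
      unfolding sum.distrib sum_distrib_left[symmetric] sum_e sum_ee using n by simp
    finally show ?thesis .
  qed
  have X: "bordered_block A S B = transpose R ** R"
  proof -
    have "bordered_block A S B $ p $ q = (transpose R ** R) $ p $ q" for p q
      unfolding gram using n inj_eq[OF bij_is_inj[OF \<sigma>]]
      by (cases p rule: sum.exhaust[case_names l r]; cases q rule: sum.exhaust[case_names l r])
        (auto simp: bordered_block_def b_def k_def A_def S_def B_def field_simps
          power2_eq_square split: sum.splits)
    then show ?thesis
      by (simp add: vec_eq_iff)
  qed
  have A_diag: "A $ i $ i = 2" for i
    using n(1,3) by (simp add: A_def divide_simps) (simp add: n_def)
  have "psd (bordered_block A S B)"
    unfolding X by (rule psd_gram)
  then have "sdp_feasible {(i, j). i \<noteq> \<sigma> j} A S B"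
    using n A_diag by (auto simp: sdp_feasible_def transpose_def vec_eq_iff)
      (auto simp: A_def B_def S_def)
  moreover have "rank (bordered_block A S B) = d + 1"
  \<comment> \<open>Above, \<open>R\<close> has only d + 1 rows. Below, \<open>S\<close> is n times
    a permutation matrix up to relabelling, hence of full rank.\<close>
  proof (rule antisym)
    have "rank (bordered_block A S B) \<le> rank R"
      unfolding X by (rule rank_mul_le_right)
    also have "\<dots> \<le> d + 1"
      using rank_bound[of R] d by simp
    finally show "rank (bordered_block A S B) \<le> d + 1" .
    have "inj ((*v) S)"
    proof (rule injI)
      fix x y assume "S *v x = S *v y"
      then have eq: "(S *v x) $ \<sigma> j = (S *v y) $ \<sigma> j" for j by simp
      have "(S *v z) $ \<sigma> j = n * z $ j" for z j
        using inj_eq[OF bij_is_inj[OF \<sigma>]]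
        by (simp add: matrix_vector_mult_def S_def if_distrib[of "\<lambda>x. x * _"] cong: if_cong)
      then show "x = y"
        using eq n by (simp add: vec_eq_iff)
    qed
    then have "rank S = CARD('m)"
      by (simp add: full_rank_injective)
    also have "\<dots> = d + 1"
      using bij_betw_same_card[OF \<sigma>] d by simp
    finally show "d + 1 \<le> rank (bordered_block A S B)"
      using rank_le_rank_bordered_block[of S A B] by simp
  qed
  moreover have "S $ i $ j = (if i = \<sigma> j then real d + 1 else 0)" for i j
    by (simp add: S_def n_def)
  moreover have "trace B = (real d + 1) * (1 + real d ^ 2)"
  proof -
    have "CARD('m) = d + 1"
      using bij_betw_same_card[OF \<sigma>] d by simp
    then show ?thesis
      using n(1) by (simp add: trace_def B_def right_diff_distrib)
        (simp add: n_def algebra_simps power2_eq_square)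
  qed
  ultimately show thesis
    by (rule that)
qed

theorem theorem3:
  fixes d :: nat
    and P :: "'a::euclidean_space set"
    and v :: "'n::finite \<Rightarrow> 'a"
    and F :: "'m::finite \<Rightarrow> 'a set"
    and Iz :: "('n \<times> 'm) set"
    and lam :: "'n \<Rightarrow> 'm \<Rightarrow> real"
  assumes "d \<ge> 2"
    and "int d simplex P"
    and "CARD('n) = d + 1" and "CARD('m) = d + 1"
    and "bij_betw v UNIV {x. x extreme_point_of P}"
    and "bij_betw F UNIV {f. f facet_of P}"
    and "Iz = {(i, j). v i \<in> F j}"
    and "\<And>i j. (i, j) \<notin> Iz \<Longrightarrow> lam i j = 2 * (real d)\<^sup>2 / (real d + 1)"
  shows "\<exists>A S B. sdp_optimal Iz lam A S B
           \<and> rank (bordered_block A S B) = d + 1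
           \<and> (\<forall>i j. (i, j) \<notin> Iz \<longrightarrow> S $ i $ j > 0)
           \<and> inscribability_certificate d Iz A S B
           \<and> inscribable P"
proof -
  obtain \<sigma> :: "'m \<Rightarrow> 'n" where \<sigma>: "bij \<sigma>" "\<And>i j. v i \<in> F j \<longleftrightarrow> i \<noteq> \<sigma> j"
    using simplex_facet_opposite_vertex[OF assms(2) _ assms(5,6)] assms(3,4) by metis
  have Iz: "Iz = {(i, j). i \<noteq> \<sigma> j}"
    using assms(7) \<sigma>(2) by simp
  have lam: "lam (\<sigma> j) j = 2 * (real d)\<^sup>2 / (real d + 1)" for j
    using assms(8) Iz by simp
  have d: "d \<ge> 1"
    using assms(1) by simp
  obtain A S B where X: "sdp_feasible Iz A S B" "rank (bordered_block A S B) = d + 1"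
      "\<And>i j. S $ i $ j = (if i = \<sigma> j then real d + 1 else 0)"
      "trace B = (real d + 1) * (1 + real d ^ 2)"
    using simplex_sdp_solution[OF assms(3) d \<sigma>(1)] unfolding Iz by metis
  have "trace A = 2 * (real d + 1)"
    using X(1) assms(3) by (simp add: sdp_feasible_def trace_def)
  \<comment> \<open>The trace is 1 + 2 (d+1) + (d+1) (1 + d^2). The d + 1 entries of
    \<open>S\<close> outside \<open>Iz\<close> all equal d + 1, so the weighted sum is 2 d^2 (d+1),
    and the difference meets the lower bound.\<close>
  then have "sdp_objective Iz lam A S B = 3 * real d + 4 - real d ^ 2 * (real d + 1)"
    using assms(4) unfolding sdp_objective_def Iz sum_graph_complement
    by (simp add: trace_bordered_block X(3,4) lam) (simp add: algebra_simps power2_eq_square)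
  then have "sdp_optimal Iz lam A S B"
    using sdp_objective_lower_bound[where lam = lam, OF assms(3) d \<sigma>(1) lam] X(1)
    unfolding sdp_optimal_def Iz by auto
  moreover have "inscribability_certificate d Iz A S B"
    using X(1-3) by (auto simp: inscribability_certificate_def sdp_feasible_def Iz)
  moreover have "inscribable P"
    using inscribable_simplex[OF assms(2)] d by simp
  ultimately show ?thesis
    using X(2,3) by (auto simp: Iz intro!: exI[of _ A] exI[of _ S] exI[of _ B])
qed

end
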